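(* Suppose that the model $\mathbb{P}_\theta$ (that is, the exponential family $\{\mathcal{P}_{A,\Theta}\}_{A\in\mathcal{A}}$) is projective, and that the log partition function $a_A(\theta)=\log z_A(\theta)$ obeys $$a_A(\theta)=r_{|A|}\,a(\theta)$$ for each $A\in\mathcal{A}$, where $|A|$ is some positive-valued measure of the size of $A$, $r_{|A|}$ is a positive monotone-increasing function of it, and $a:\Theta\to\mathbb{R}$ is differentiable (at least at $\theta$). Then the maximum likelihood estimator exists and is strongly consistent.
   Context: Let $\mathbb{I}$ be a denumerable set and $\mathcal{A}$ a collection of finite subsets of $\mathbb{I}$, partially ordered by inclusion, which is an ideal: all subsets of a member of $\mathcal{A}$, and the union of any two members of $\mathcal{A}$, belong to $\mathcal{A}$. To each $A\in\mathcal{A}$ is attached a countable set $\mathcal{X}_A$, in such a way that $A\subset B$ if and only if $\mathcal{X}_B=\mathcal{X}_A\times\mathcal{X}_{B\setminus A}$; for $A\subset B$, $\pi_{B\mapsto A}:\mathcal{X}_B\to\mathcal{X}_A$ is the projection $\pi_{B\mapsto A}(x_A,x_{B\setminus A})=x_A$. Let $\Theta\subseteq\mathbb{R}^d$ be a fixed open set. For each $A\in\mathcal{A}$ let $t_A:\mathcal{X}_A\to\mathbb{R}^d$ be the function of minimal sufficient statistics, and let the partition function $z_A:\Theta\to\mathbb{R}$ be $z_A(\theta)=\sum_{x\in\mathcal{X}_A}e^{\langle\theta,t_A(x)\rangle}$. Let $\mathbb{P}_{A,\theta}$ be the probability distribution on $\mathcal{X}_A$ with density $p_{A,\theta}(x)=e^{\langle\theta,t_A(x)\rangle}/z_A(\theta)$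 with respect to counting measure, let $X_A$ be a random variable with distribution $\mathbb{P}_{A,\theta}$, and let $\mathcal{P}_{A,\Theta}=\{\mathbb{P}_{A,\theta}\}_{\theta\in\Theta}$. The family $\{\mathcal{P}_{A,\Theta}\}_{A\in\mathcal{A}}$ is projective if, for all $A\subset B$ in $\mathcal{A}$, $\mathbb{P}_{A,\theta}=\mathbb{P}_{B,\theta}\circ\pi_{B\mapsto A}^{-1}$ for all $\theta\in\Theta$. Within a projective family, $\mathbb{P}_\theta$ denotes the infinite-dimensional distribution with marginals $\mathbb{P}_{A,\theta}$, which exists by the Kolmogorov extension theorem. The maximum likelihood estimator $\widehat{\theta}$ based on $X_A$ is the parameter value maximizing the likelihood $p_{A,\vartheta}(X_A)$ over $\vartheta$. Strong consistency means that, along a growing sequence of sets $A$ with $r_{|A|}\to\infty$, $\widehat{\theta}$ converges to $\theta$ almost surely under $\mathbb{P}_\theta$.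
   Formalization: "The maximum likelihood estimator exists" is read as: almost surely, for all sufficiently large sets A of the growing sequence, a unique maximizer exists; existence for every A fails (one Bernoulli observation). Scaling and minimality are required only for nonempty A. *)

theory Defs
  imports "HOL-Probability.Probability"
begin

text \<open>
  A configuration on a finite index set \<open>A\<close> is a function that is \<open>undefined\<close> outside \<open>A\<close>. With
  this encoding \<open>restrict x A\<close> is the projection of a configuration \<open>x\<close> on \<open>B \<supseteq> A\<close> to \<open>A\<close>, and
  \<open>merge A (B - A)\<close> identifies the pair \<open>(x\<^sub>A, x\<^sub>B\<^sub>-\<^sub>A)\<close> with a configuration on \<open>B\<close>.
\<close>

definition partition_function ::
    "('i set \<Rightarrow> ('i \<Rightarrow> 'x) set) \<Rightarrow> ('i set \<Rightarrow> ('i \<Rightarrow> 'x) \<Rightarrow> real ^ 'd) \<Rightarrow> 'i set \<Rightarrow> real ^ 'd \<Rightarrow> real"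
  where "partition_function X t A \<theta> = (\<Sum>\<^sub>\<infinity>x\<in>X A. exp (\<theta> \<bullet> t A x))"

definition log_partition ::
    "('i set \<Rightarrow> ('i \<Rightarrow> 'x) set) \<Rightarrow> ('i set \<Rightarrow> ('i \<Rightarrow> 'x) \<Rightarrow> real ^ 'd) \<Rightarrow> 'i set \<Rightarrow> real ^ 'd \<Rightarrow> real"
  where "log_partition X t A \<theta> = ln (partition_function X t A \<theta>)"

definition family_density ::
    "('i set \<Rightarrow> ('i \<Rightarrow> 'x) set) \<Rightarrow> ('i set \<Rightarrow> ('i \<Rightarrow> 'x) \<Rightarrow> real ^ 'd) \<Rightarrow> 'i set \<Rightarrow> real ^ 'd
      \<Rightarrow> ('i \<Rightarrow> 'x) \<Rightarrow> real"
  where "family_density X t A \<theta> x = exp (\<theta> \<bullet> t A x) / partition_function X t A \<theta>"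

definition family_dist ::
    "('i set \<Rightarrow> ('i \<Rightarrow> 'x) set) \<Rightarrow> ('i set \<Rightarrow> ('i \<Rightarrow> 'x) \<Rightarrow> real ^ 'd) \<Rightarrow> 'i set \<Rightarrow> real ^ 'd
      \<Rightarrow> ('i \<Rightarrow> 'x) measure"
  where "family_dist X t A \<theta> =
    density (count_space (X A)) (\<lambda>x. ennreal (family_density X t A \<theta> x))"

text \<open>
  Minimality is meant in the sense of exponential families: the components of the statistic satisfy
  no affine relation. Minimal sufficiency alone (being a function of every sufficient statistic)
  holds automatically when the parameter set is open and nonempty, and it does not exclude
  constant statistics, for which every parameter maximizes the likelihood.
\<close>

definition minimal_statistic :: "('i \<Rightarrow> 'x) set \<Rightarrow> (('i \<Rightarrow> 'x) \<Rightarrow> real ^ 'd) \<Rightarrow> bool"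
  where "minimal_statistic S T \<longleftrightarrow> (\<forall>c b. (\<forall>x\<in>S. c \<bullet> T x = b) \<longrightarrow> c = 0)"

text \<open>
  For \<open>A = B\<close>, the product condition forces \<open>X {}\<close> to be a singleton, so a statistic
  on it is constant; minimality can therefore only be asked for nonempty index sets.
\<close>

locale exponential_family_system =
  fixes I :: "'i set"
    and \<A> :: "'i set set"
    and X :: "'i set \<Rightarrow> ('i \<Rightarrow> 'x) set"
    and \<Theta> :: "(real ^ 'd) set"
    and t :: "'i set \<Rightarrow> ('i \<Rightarrow> 'x) \<Rightarrow> real ^ 'd"
  assumes index_countable: "countable I"
    and index_infinite: "infinite I"
    and ideal_finite: "A \<in> \<A> \<Longrightarrow> finite A \<and> A \<subseteq> I"
    and ideal_subset: "A \<in> \<A> \<Longrightarrow> C \<subseteq> A \<Longrightarrow> C \<in> \<A>"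
    and ideal_union: "A \<in> \<A> \<Longrightarrow> B \<in> \<A> \<Longrightarrow> A \<union> B \<in> \<A>"
    and config_extensional: "A \<in> \<A> \<Longrightarrow> X A \<subseteq> extensional A"
    and config_countable: "A \<in> \<A> \<Longrightarrow> countable (X A)"
    and config_nonempty: "A \<in> \<A> \<Longrightarrow> X A \<noteq> {}"
    and config_product: "A \<in> \<A> \<Longrightarrow> B \<in> \<A> \<Longrightarrow>
          A \<subseteq> B \<longleftrightarrow> X B = merge A (B - A) ` (X A \<times> X (B - A))"
    and parameters_open: "open \<Theta>"
    and partition_finite: "A \<in> \<A> \<Longrightarrow> \<theta> \<in> \<Theta> \<Longrightarrow> (\<lambda>x. exp (\<theta> \<bullet> t A x)) summable_on X A"
    and statistic_minimal: "A \<in> \<A> \<Longrightarrow> A \<noteq> {} \<Longrightarrow> minimal_statistic (X A) (t A)"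

definition projective_exponential_family ::
    "'i set set \<Rightarrow> ('i set \<Rightarrow> ('i \<Rightarrow> 'x) set) \<Rightarrow> (real ^ 'd) set
      \<Rightarrow> ('i set \<Rightarrow> ('i \<Rightarrow> 'x) \<Rightarrow> real ^ 'd) \<Rightarrow> bool"
  where "projective_exponential_family \<A> X \<Theta> t \<longleftrightarrow>
    (\<forall>A\<in>\<A>. \<forall>B\<in>\<A>. A \<subseteq> B \<longrightarrow>
      (\<forall>\<theta>\<in>\<Theta>. family_dist X t A \<theta> =
        distr (family_dist X t B \<theta>) (count_space (X A)) (\<lambda>x. restrict x A)))"

definition coordinate_space :: "('i set \<Rightarrow> ('i \<Rightarrow> 'x) set) \<Rightarrow> 'i \<Rightarrow> 'x set"
  where "coordinate_space X i = (\<lambda>x. x i) ` X {i}"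

text \<open>
  The infinite-dimensional distribution lives on the product of the coordinate spaces and is
  determined by its marginals over the ideal.
\<close>

definition infinite_distribution ::
    "'i set set \<Rightarrow> ('i set \<Rightarrow> ('i \<Rightarrow> 'x) set) \<Rightarrow> ('i set \<Rightarrow> ('i \<Rightarrow> 'x) \<Rightarrow> real ^ 'd) \<Rightarrow> real ^ 'd
      \<Rightarrow> ('i \<Rightarrow> 'x) measure \<Rightarrow> bool"
  where "infinite_distribution \<A> X t \<theta> P \<longleftrightarrow>
    prob_space P \<and>
    sets P = sets (\<Pi>\<^sub>M i\<in>\<Union>\<A>. count_space (coordinate_space X i)) \<and>
    (\<forall>A\<in>\<A>. distr P (count_space (X A)) (\<lambda>\<omega>. restrict \<omega> A) = family_dist X t A \<theta>)"

definition is_mle ::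
    "('i set \<Rightarrow> ('i \<Rightarrow> 'x) set) \<Rightarrow> (real ^ 'd) set \<Rightarrow> ('i set \<Rightarrow> ('i \<Rightarrow> 'x) \<Rightarrow> real ^ 'd)
      \<Rightarrow> 'i set \<Rightarrow> ('i \<Rightarrow> 'x) \<Rightarrow> real ^ 'd \<Rightarrow> bool"
  where "is_mle X \<Theta> t A x = is_arg_max (\<lambda>\<theta>. family_density X t A \<theta> x) (\<lambda>\<theta>. \<theta> \<in> \<Theta>)"

definition mle ::
    "('i set \<Rightarrow> ('i \<Rightarrow> 'x) set) \<Rightarrow> (real ^ 'd) set \<Rightarrow> ('i set \<Rightarrow> ('i \<Rightarrow> 'x) \<Rightarrow> real ^ 'd)
      \<Rightarrow> 'i set \<Rightarrow> ('i \<Rightarrow> 'x) \<Rightarrow> real ^ 'd"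
  where "mle X \<Theta> t A x = arg_max (\<lambda>\<theta>. family_density X t A \<theta> x) (\<lambda>\<theta>. \<theta> \<in> \<Theta>)"

context exponential_family_system
begin

lemma config_split:
  assumes "A \<in> \<A>" "B \<in> \<A>" "A \<subseteq> B"
  shows "x \<in> X B \<longleftrightarrow> x \<in> extensional B \<and> restrict x A \<in> X A \<and> restrict x (B - A) \<in> X (B - A)"
proof -
  have BA: "B - A \<in> \<A>" using ideal_subset[OF assms(2)] by blast
  have eq: "X B = merge A (B - A) ` (X A \<times> X (B - A))"
    using config_product[OF assms(1,2)] assms(3) by blast
  show ?thesis
  proof
    assume "x \<in> X B"
    then obtain y z where yz: "y \<in> X A" "z \<in> X (B - A)" "x = merge A (B - A) (y, z)"
      using eq by auto
    have "y \<in> extensional A" "z \<in> extensional (B - A)"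
      using yz config_extensional assms(1) BA by auto
    then have "restrict x A = y" "restrict x (B - A) = z"
      unfolding yz(3) by (auto simp: merge_def restrict_def extensional_def fun_eq_iff)
    then show "x \<in> extensional B \<and> restrict x A \<in> X A \<and> restrict x (B - A) \<in> X (B - A)"
      using yz \<open>x \<in> X B\<close> config_extensional[OF assms(2)] by auto
  next
    assume *: "x \<in> extensional B \<and> restrict x A \<in> X A \<and> restrict x (B - A) \<in> X (B - A)"
    have "x = merge A (B - A) (restrict x A, restrict x (B - A))"
      using * assms(3) by (auto simp: merge_def restrict_def extensional_def fun_eq_iff)
    then show "x \<in> X B" unfolding eq using * by blast
  qed
qed

lemma config_empty: "{} \<in> \<A> \<Longrightarrow> X {} = {\<lambda>_. undefined}"
  using config_extensional[of "{}"] config_nonempty[of "{}"]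
  by (simp add: subset_singleton_iff)

lemma config_eq_PiE:
  assumes "A \<in> \<A>"
  shows "X A = (\<Pi>\<^sub>E i\<in>A. coordinate_space X i)"
proof -
  have "finite A" using ideal_finite[OF assms] by simp
  then show ?thesis using assms
  proof (induction A rule: finite_induct)
    case empty
    then show ?case using config_empty by simp
  next
    case (insert j F)
    have F: "F \<in> \<A>" and j: "{j} \<in> \<A>" using ideal_subset[OF insert.prems] by auto
    have d: "insert j F - {j} = F" using insert.hyps by auto
    have single: "restrict x {j} \<in> X {j} \<longleftrightarrow> x j \<in> coordinate_space X j" for x
    proof
      assume "restrict x {j} \<in> X {j}"
      then show "x j \<in> coordinate_space X j"
        unfolding coordinate_space_def by (intro image_eqI[of _ _ "restrict x {j}"]) auto
    next
      assume "x j \<in> coordinate_space X j"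
      then obtain y where y: "y \<in> X {j}" "x j = y j" unfolding coordinate_space_def by auto
      have "y \<in> extensional {j}" using y config_extensional[OF j] by auto
      then have "restrict x {j} = y" using y(2)
        by (auto simp: restrict_def extensional_def fun_eq_iff)
      then show "restrict x {j} \<in> X {j}" using y by simp
    qed
    show ?case
    proof (rule set_eqI)
      fix x
      have "x \<in> X (insert j F) \<longleftrightarrow>
          x \<in> extensional (insert j F) \<and> x j \<in> coordinate_space X j \<and> restrict x F \<in> X F"
        using config_split[OF j insert.prems, of x] single[of x] by (simp add: d)
      also have "\<dots> \<longleftrightarrow> x \<in> (\<Pi>\<^sub>E i\<in>insert j F. coordinate_space X i)"
        using insert.IH[OF F] by (auto simp: PiE_iff)
      finally show "x \<in> X (insert j F) \<longleftrightarrow> x \<in> (\<Pi>\<^sub>E i\<in>insert j F. coordinate_space X i)" .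
    qed
  qed
qed

lemma coordinate_space_countable:
  assumes "i \<in> \<Union>\<A>"
  shows "countable (coordinate_space X i)"
proof -
  obtain A where "A \<in> \<A>" "i \<in> A" using assms by (rule UnionE)
  then have "{i} \<in> \<A>" by (intro ideal_subset[of A "{i}"]) simp_all
  then show ?thesis
    unfolding coordinate_space_def by (intro countable_image config_countable)
qed

lemma measurable_projection:
  assumes "A \<in> \<A>" and P: "infinite_distribution \<A> X t \<theta> P"
  shows "(\<lambda>\<omega>. restrict \<omega> A) \<in> measurable P (count_space (X A))"
proof -
  let ?M = "\<lambda>i. count_space (coordinate_space X i)"
  have sub: "A \<subseteq> \<Union>\<A>" using assms by auto
  define B where "B i = (if i \<in> A then coordinate_space X i else {})" for i
  have B: "countable (B i)" for i
    using coordinate_space_countable[OF subsetD[OF sub]] by (simp add: B_def)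
  have "Pi\<^sub>M A ?M = Pi\<^sub>M A (\<lambda>i. count_space (B i))"
    by (rule PiM_cong) (simp_all add: B_def)
  also have "\<dots> = count_space (Pi\<^sub>E A B)"
    using ideal_finite[OF assms(1)] by (intro count_space_PiM_finite B) simp
  also have "Pi\<^sub>E A B = Pi\<^sub>E A (coordinate_space X)"
    by (rule PiE_cong) (simp add: B_def)
  finally have "Pi\<^sub>M A ?M = count_space (Pi\<^sub>E A (coordinate_space X))" .
  then have target: "Pi\<^sub>M A ?M = count_space (X A)"
    by (simp only: config_eq_PiE[OF assms(1)])
  have sets_P: "sets P = sets (Pi\<^sub>M (\<Union>\<A>) ?M)"
    using P unfolding infinite_distribution_def by simp
  have "(\<lambda>\<omega>. restrict \<omega> A) \<in> measurable (Pi\<^sub>M (\<Union>\<A>) ?M) (Pi\<^sub>M A ?M)"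
    using sub by (rule measurable_restrict_subset)
  then show ?thesis
    unfolding target measurable_cong_sets[OF sets_P refl] .
qed

end

end

theory Submission
  imports Defs
begin

text \<open>
  Under \<open>\<theta>\<close>, projectivity makes the likelihood ratio of any \<open>\<phi> \<in> \<Theta>\<close> against \<open>\<theta>\<close>, computed on the
  growing sets \<open>A n\<close>, a nonnegative martingale of mean one. Ville's maximal inequality then says
  that the ratio stays bounded in \<open>n\<close> almost surely (\<open>AE_likelihood_ratio_bounded\<close>). Because
  the log partition function is \<open>R n * a\<close>, where \<open>R n\<close> is the scale factor of \<open>A n\<close>, the
  logarithm of the ratio is \<open>(\<phi> - \<theta>) \<bullet> t\<^sub>n - R n * (a \<phi> - a \<theta>)\<close>, with \<open>t\<^sub>n\<close> the statistic observed
  on \<open>A n\<close>. Dividing a bounded quantity by \<open>R n \<rightarrow> \<infinity>\<close> gives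
  \<open>limsup (\<phi> - \<theta>) \<bullet> t\<^sub>n / R n \<le> a \<phi> - a \<theta>\<close>. For \<open>\<phi> = \<theta> + u v\<close> with \<open>u\<close> decreasing to \<open>0\<close> along a
  sequence, the difference quotients on the right converge to the derivative of \<open>a\<close> in direction
  \<open>v\<close>. Taking \<open>v\<close> and \<open>- v\<close> over a basis, \<open>t\<^sub>n / R n\<close> converges almost surely to the gradient
  \<open>m\<close> of \<open>a\<close> at \<open>\<theta>\<close> (\<open>AE_normalized_statistic_tendsto\<close>).

  The remainder is deterministic. The normalized log-likelihood \<open>\<phi> \<bullet> t\<^sub>n / R n - a \<phi>\<close> converges to
  \<open>\<phi> \<bullet> m - a \<phi>\<close>, which has its strict maximum at \<open>\<theta>\<close>: minimality of the statistic makes the log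
  partition function strictly convex (\<open>log_partition_strictly_convex\<close>). Since \<open>\<Theta>\<close> is open but
  need not be convex, and it may be unbounded, \<open>a\<close> is extended to the convex set of all parameters
  with a finite partition function. There the gap below the maximum grows at least linearly in the distance
  from \<open>\<theta>\<close>, so a small linear perturbation can neither move the maximizer far nor create a second
  one (\<open>tilted_concave_argmax_near\<close>).
\<close>

section \<open>Strict convexity of the log partition function\<close>

lemma exp_weighted_mean_less:
  fixes p q :: real
  assumes "p \<noteq> q" "0 < u" "0 < v" "u + v = 1"
  shows "exp (u * p + v * q) < u * exp p + v * exp q"
proof -
  define s where "s = u * p + v * q"
  have v: "v = 1 - u" using assms by simp
  have "p - s = v * (p - q)" unfolding s_def v by (simp add: algebra_simps)
  then have "p \<noteq> s" using assms by auto
  \<comment> \<open>Compare \<open>exp\<close> with its tangent at the weighted mean \<open>s\<close>, which is strictly below it at \<open>p\<close>.\<close>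
  have above: "exp s * (1 + (x - s)) \<le> exp x" for x
    using mult_left_mono[OF exp_ge_add_one_self[of "x - s"], of "exp s"] by (simp flip: exp_add)
  have "1 + (p - s) < exp (p - s)"
    using exp_minus_greater[of "s - p"] \<open>p \<noteq> s\<close> by simp
  then have "exp s * (1 + (p - s)) < exp p"
    by (simp add: exp_diff pos_less_divide_eq mult.commute)
  then have "u * (exp s * (1 + (p - s))) + v * (exp s * (1 + (q - s))) < u * exp p + v * exp q"
    using above[of q] assms by (intro add_less_le_mono mult_strict_left_mono mult_left_mono) auto
  moreover have "u * (exp s * (1 + (p - s))) + v * (exp s * (1 + (q - s)))
      = exp s * ((u + v) + (u * p + v * q - (u + v) * s))"
    by (simp add: algebra_simps)
  ultimately show ?thesis using assms by (simp add: s_def)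
qed

lemma infsum_exp_pos:
  fixes f :: "'a \<Rightarrow> real"
  assumes "(\<lambda>x. exp (f x)) summable_on S" "S \<noteq> {}"
  shows "0 < (\<Sum>\<^sub>\<infinity>x\<in>S. exp (f x))"
proof -
  obtain y where "y \<in> S" using assms by blast
  then show ?thesis
    using has_sum_strict_mono[of "\<lambda>_. 0" S 0 "\<lambda>x. exp (f x)"] assms(1)
    by (auto intro: has_sum_0)
qed

text \<open>
  With \<open>u + v = 1\<close>, the weighted geometric mean of the two densities is pointwise at most their
  weighted arithmetic mean, which has total mass \<open>1\<close>; the mass of the geometric mean is the ratio
  whose logarithm is the convexity gap. The inequality is strict at some configuration, because
  otherwise the densities agree and \<open>(\<phi> - \<psi>) \<bullet> t A\<close> is constant, against minimality.
\<close>

lemma log_partition_strictly_convex: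
  fixes \<phi> \<psi> :: "real ^ 'd"
  assumes min: "minimal_statistic (X A) (t A)"
    and ne: "X A \<noteq> {}"
    and sum_\<phi>: "(\<lambda>x. exp (\<phi> \<bullet> t A x)) summable_on X A"
    and sum_\<psi>: "(\<lambda>x. exp (\<psi> \<bullet> t A x)) summable_on X A"
    and "\<phi> \<noteq> \<psi>" and uv: "0 < u" "0 < v" "u + v = 1"
  shows "(\<lambda>x. exp ((u *\<^sub>R \<phi> + v *\<^sub>R \<psi>) \<bullet> t A x)) summable_on X A"
    and "log_partition X t A (u *\<^sub>R \<phi> + v *\<^sub>R \<psi>)
          < u * log_partition X t A \<phi> + v * log_partition X t A \<psi>"
proof -
  define lp where "lp \<eta> x = \<eta> \<bullet> t A x - log_partition X t A \<eta>" for \<eta> x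
  define mix where "mix x = exp (u * lp \<phi> x + v * lp \<psi> x)" for x
  define c where "c = u * log_partition X t A \<phi> + v * log_partition X t A \<psi>"
  have total: "((\<lambda>x. exp (lp \<eta> x)) has_sum 1) (X A)"
    if s: "(\<lambda>x. exp (\<eta> \<bullet> t A x)) summable_on X A" for \<eta>
  proof -
    have pos: "0 < partition_function X t A \<eta>"
      unfolding partition_function_def by (rule infsum_exp_pos[OF s ne])
    have "((\<lambda>x. inverse (partition_function X t A \<eta>) * exp (\<eta> \<bullet> t A x))
        has_sum inverse (partition_function X t A \<eta>) * partition_function X t A \<eta>) (X A)"
      using s unfolding partition_function_def by (intro has_sum_cmult_right has_sum_infsum)
    then show ?thesis
      using pos by (simp add: lp_def log_partition_def exp_diff field_simps)
  qed
  have bound: "((\<lambda>x. u * exp (lp \<phi> x) + v * exp (lp \<psi> x)) has_sum 1) (X A)"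
    using has_sum_add[OF has_sum_cmult_right[OF total[OF sum_\<phi>]] has_sum_cmult_right[OF total[OF sum_\<psi>]],
        of u v] uv by simp
  have le: "mix x \<le> u * exp (lp \<phi> x) + v * exp (lp \<psi> x)" for x
  proof (cases "lp \<phi> x = lp \<psi> x")
    case True
    then show ?thesis using uv by (simp add: mix_def flip: distrib_right)
  next
    case False
    then show ?thesis using exp_weighted_mean_less[OF _ uv] by (simp add: mix_def less_imp_le)
  qed
  have "\<exists>x\<in>X A. lp \<phi> x \<noteq> lp \<psi> x"
  proof (rule ccontr)
    assume "\<not> ?thesis"
    then have "\<forall>x\<in>X A. (\<phi> - \<psi>) \<bullet> t A x = log_partition X t A \<phi> - log_partition X t A \<psi>"
      by (auto simp: lp_def algebra_simps)
    then show False using min \<open>\<phi> \<noteq> \<psi>\<close> unfolding minimal_statistic_def by force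
  qed
  then obtain y where y: "y \<in> X A" "lp \<phi> y \<noteq> lp \<psi> y" by blast
  have "mix summable_on X A"
    using has_sum_imp_summable[OF bound] by (rule summable_on_comparison_test) (use le in \<open>auto simp: mix_def\<close>)
  then have "infsum mix (X A) < 1"
    using has_sum_strict_mono[OF has_sum_infsum bound, of mix y] le y exp_weighted_mean_less[OF y(2) uv]
    by (simp add: mix_def)
  have mix_eq: "exp ((u *\<^sub>R \<phi> + v *\<^sub>R \<psi>) \<bullet> t A x) = exp c * mix x" for x
    unfolding mix_def c_def lp_def by (simp add: algebra_simps flip: exp_add)
  show mix_summable: "(\<lambda>x. exp ((u *\<^sub>R \<phi> + v *\<^sub>R \<psi>) \<bullet> t A x)) summable_on X A"
    unfolding mix_eq using \<open>mix summable_on X A\<close> by (rule summable_on_cmult_right)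
  have "partition_function X t A (u *\<^sub>R \<phi> + v *\<^sub>R \<psi>) = exp c * infsum mix (X A)"
    unfolding partition_function_def mix_eq by (rule infsum_cmult_right')
  also have "\<dots> < exp c" using \<open>infsum mix (X A) < 1\<close> by simp
  finally show "log_partition X t A (u *\<^sub>R \<phi> + v *\<^sub>R \<psi>) < c"
    using infsum_exp_pos[OF mix_summable ne] unfolding log_partition_def partition_function_def
    by (metis ln_exp ln_less_cancel_iff exp_gt_zero)
qed

section \<open>Maximizers of tilted concave functions\<close>

text \<open>
  Chords through \<open>\<theta>\<close> dominate the derivative, which gives the weak inequality; applied to
  the midpoint of \<open>\<theta>\<close> and \<open>x\<close> it becomes strict, as the value there is below the chord.
\<close>

lemma strictly_convex_above_tangent:
  fixes g :: "'a::real_inner \<Rightarrow> real"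
  assumes "convex S" "\<theta> \<in> S" "x \<in> S" "x \<noteq> \<theta>"
    and strict: "\<And>x y u v. x \<in> S \<Longrightarrow> y \<in> S \<Longrightarrow> x \<noteq> y \<Longrightarrow> 0 < u \<Longrightarrow> 0 < v \<Longrightarrow> u + v = 1 \<Longrightarrow>
          g (u *\<^sub>R x + v *\<^sub>R y) < u * g x + v * g y"
    and der: "(g has_derivative (\<lambda>v. m \<bullet> v)) (at \<theta>)"
  shows "m \<bullet> (x - \<theta>) < g x - g \<theta>"
proof -
  have tangent: "m \<bullet> (y - \<theta>) \<le> g y - g \<theta>" if y: "y \<in> S" "y \<noteq> \<theta>" for y
  proof -
    define k where "k u = g (\<theta> + u *\<^sub>R (y - \<theta>))" for u
    have "((\<lambda>u. \<theta> + u *\<^sub>R (y - \<theta>)) has_derivative (\<lambda>u. u *\<^sub>R (y - \<theta>))) (at 0)"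
      by (auto intro!: derivative_eq_intros)
    then have "(k has_derivative (\<lambda>u. m \<bullet> (u *\<^sub>R (y - \<theta>)))) (at 0)"
      unfolding k_def by (rule has_derivative_compose) (use der in simp)
    then have "(k has_real_derivative m \<bullet> (y - \<theta>)) (at 0)"
      by (simp add: has_field_derivative_def mult_commute_abs)
    then have "((\<lambda>u. (k u - k 0) / u) \<longlongrightarrow> m \<bullet> (y - \<theta>)) (at_right 0)"
      using filterlim_mono[OF _ order_refl at_within_le_at] unfolding DERIV_def by fastforce
    moreover have "\<forall>\<^sub>F u in at_right 0. (k u - k 0) / u \<le> g y - g \<theta>"
    proof -
      have "(k u - k 0) / u \<le> g y - g \<theta>" if "0 < u" "u < 1" for u
      proof -
        have "\<theta> + u *\<^sub>R (y - \<theta>) = (1 - u) *\<^sub>R \<theta> + u *\<^sub>R y" by (simp add: algebra_simps)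
        then have "k u < (1 - u) * g \<theta> + u * g y"
          using strict[of \<theta> y "1 - u" u] assms y that unfolding k_def by simp
        then have "k u - k 0 \<le> (g y - g \<theta>) * u" unfolding k_def by (simp add: algebra_simps)
        then show ?thesis using that by (simp add: pos_divide_le_eq)
      qed
      then show ?thesis by (intro eventually_at_rightI[of 0 1]) auto
    qed
    ultimately show ?thesis by (rule tendsto_upperbound) simp
  qed
  define y where "y = (1/2) *\<^sub>R \<theta> + (1/2) *\<^sub>R x"
  have y_diff: "y - \<theta> = (1/2) *\<^sub>R (x - \<theta>)"
    unfolding y_def by (simp add: algebra_simps flip: scaleR_add_left)
  have "y \<in> S" unfolding y_def using assms by (intro convexD) auto
  moreover have "y \<noteq> \<theta>" using y_diff assms by auto
  ultimately have "m \<bullet> (y - \<theta>) \<le> g y - g \<theta>" by (rule tangent)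
  moreover have "g y < (1/2) * g \<theta> + (1/2) * g x"
    unfolding y_def using assms by (intro strict) auto
  ultimately show ?thesis unfolding y_diff by simp
qed

text \<open>
  On a small sphere around \<open>\<theta>\<close> the convex function \<open>h \<phi> = g \<phi> - m \<bullet> \<phi>\<close> exceeds \<open>h \<theta>\<close> by a positive
  amount, and convexity along rays from \<open>\<theta>\<close> propagates this to linear growth with some slope
  \<open>\<kappa> > 0\<close> outside the sphere. For large \<open>n\<close>, replacing \<open>m\<close> by \<open>\<tau> n\<close> tilts \<open>h\<close> by a linear function of norm less
  than \<open>\<kappa>\<close>, so only points inside the sphere can compete with \<open>\<theta>\<close>. A maximizer there exists by
  compactness and is unique by strict concavity. The larger set \<open>S\<close> provides the rays: the segment
  from \<open>\<theta>\<close> to a point of \<open>\<Theta>\<close> may leave \<open>\<Theta>\<close>.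
\<close>

lemma tilted_concave_argmax_near:
  fixes g :: "'a::euclidean_space \<Rightarrow> real"
  assumes S: "convex S" "\<Theta> \<subseteq> S" and \<Theta>: "open \<Theta>" "\<theta> \<in> \<Theta>"
    and strict: "\<And>x y u v. x \<in> S \<Longrightarrow> y \<in> S \<Longrightarrow> x \<noteq> y \<Longrightarrow> 0 < u \<Longrightarrow> 0 < v \<Longrightarrow> u + v = 1 \<Longrightarrow>
          g (u *\<^sub>R x + v *\<^sub>R y) < u * g x + v * g y"
    and der: "(g has_derivative (\<lambda>v. m \<bullet> v)) (at \<theta>)"
    and lim: "\<tau> \<longlonglongrightarrow> m" and "0 < \<epsilon>"
  shows "\<forall>\<^sub>F n in sequentially. \<exists>\<phi>\<in>ball \<theta> \<epsilon>.
      \<forall>\<psi>. is_arg_max (\<lambda>\<phi>. \<phi> \<bullet> \<tau> n - g \<phi>) (\<lambda>\<phi>. \<phi> \<in> \<Theta>) \<psi> \<longleftrightarrow> \<psi> = \<phi>"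
proof -
  obtain \<rho> where \<rho>: "0 < \<rho>" "ball \<theta> \<rho> \<subseteq> \<Theta>" using \<Theta> by (meson openE)
  define \<delta> where "\<delta> = min \<rho> \<epsilon> / 2"
  have \<delta>: "0 < \<delta>" "\<delta> < \<rho>" "\<delta> < \<epsilon>" using \<rho> \<open>0 < \<epsilon>\<close> by (auto simp: \<delta>_def)
  have cball: "cball \<theta> \<delta> \<subseteq> \<Theta>" using \<rho> \<delta> by force
  have "\<theta> \<in> S" using S \<Theta> by auto
  have conv: "convex_on (ball \<theta> \<rho>) g"
  proof (rule convex_onI)
    show "convex (ball \<theta> \<rho>)" by simp
    fix u x y assume *: "0 < (u::real)" "u < 1" "x \<in> ball \<theta> \<rho>" "y \<in> ball \<theta> \<rho>"
    show "g ((1 - u) *\<^sub>R x + u *\<^sub>R y) \<le> (1 - u) * g x + u * g y"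
    proof (cases "x = y")
      case True
      then show ?thesis by (simp add: algebra_simps flip: scaleR_add_left)
    next
      case False
      then show ?thesis using * \<rho> S by (intro less_imp_le strict) auto
    qed
  qed
  have cont: "continuous_on (cball \<theta> \<delta>) g"
    using convex_on_continuous[OF open_ball conv] by (rule continuous_on_subset) (use \<delta> in auto)
  define h where "h \<phi> = g \<phi> - m \<bullet> \<phi>" for \<phi>
  have "continuous_on (sphere \<theta> \<delta>) h"
    unfolding h_def by (intro continuous_intros continuous_on_subset[OF cont]) auto
  then obtain s where s: "s \<in> sphere \<theta> \<delta>" "\<And>y. y \<in> sphere \<theta> \<delta> \<Longrightarrow> h s \<le> h y"
    using continuous_attains_inf[of "sphere \<theta> \<delta>" h] \<delta> by auto
  define \<kappa> where "\<kappa> = (h s - h \<theta>) / \<delta>"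
  have "s \<in> S" "s \<noteq> \<theta>" using s \<delta> cball S by auto
  then have "m \<bullet> (s - \<theta>) < g s - g \<theta>"
    by (rule strictly_convex_above_tangent[OF S(1) \<open>\<theta> \<in> S\<close> _ _ _ der]) (rule strict)
  then have "h \<theta> < h s" by (simp add: h_def inner_diff_right)
  then have "0 < \<kappa>" using \<delta> by (simp add: \<kappa>_def)
  have linear_growth: "\<kappa> * norm (\<phi> - \<theta>) \<le> h \<phi> - h \<theta>" if "\<phi> \<in> S" "\<delta> \<le> norm (\<phi> - \<theta>)" for \<phi>
  proof -
    define u where "u = \<delta> / norm (\<phi> - \<theta>)"
    define y where "y = (1 - u) *\<^sub>R \<theta> + u *\<^sub>R \<phi>"
    have pos: "0 < norm (\<phi> - \<theta>)" using that \<delta> by linarith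
    have u: "0 < u" "u \<le> 1" using \<delta> that pos by (auto simp: u_def)
    have "y - \<theta> = u *\<^sub>R (\<phi> - \<theta>)" by (simp add: y_def algebra_simps)
    then have "norm (y - \<theta>) = \<delta>" using pos \<delta> by (simp add: u_def)
    then have "h s \<le> h y" by (intro s) (simp add: dist_norm norm_minus_commute)
    moreover have "g y \<le> (1 - u) * g \<theta> + u * g \<phi>"
    proof (cases "u = 1")
      case True
      then show ?thesis by (simp add: y_def)
    next
      case False
      then show ?thesis unfolding y_def using u pos that \<open>\<theta> \<in> S\<close> by (intro less_imp_le strict) auto
    qed
    ultimately have "h s - h \<theta> \<le> u * (h \<phi> - h \<theta>)"
      by (simp add: h_def y_def algebra_simps)
    then have "(h s - h \<theta>) / u \<le> h \<phi> - h \<theta>" using u by (simp add: pos_divide_le_eq mult.commute)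
    then show ?thesis using pos \<delta> by (simp add: \<kappa>_def u_def)
  qed
  have "\<forall>\<^sub>F n in sequentially. norm (\<tau> n - m) < \<kappa>"
    using tendstoD[OF lim \<open>0 < \<kappa>\<close>] by (simp add: dist_norm)
  then show ?thesis
  proof (rule eventually_mono)
    fix n assume close: "norm (\<tau> n - m) < \<kappa>"
    define f where "f \<phi> = \<phi> \<bullet> \<tau> n - g \<phi>" for \<phi>
    have far: "f \<phi> < f \<theta>" if "\<phi> \<in> S" "\<delta> \<le> norm (\<phi> - \<theta>)" for \<phi>
    proof -
      have "f \<phi> - f \<theta> = (\<phi> - \<theta>) \<bullet> (\<tau> n - m) - (h \<phi> - h \<theta>)"
        by (simp add: f_def h_def algebra_simps inner_commute)
      also have "\<dots> \<le> norm (\<phi> - \<theta>) * norm (\<tau> n - m) - \<kappa> * norm (\<phi> - \<theta>)"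
        by (intro diff_mono norm_cauchy_schwarz linear_growth that)
      also have "\<dots> = norm (\<phi> - \<theta>) * (norm (\<tau> n - m) - \<kappa>)" by (simp add: algebra_simps)
      also have "\<dots> < 0" using that \<delta> close by (intro mult_pos_neg) linarith+
      finally show ?thesis by simp
    qed
    have "continuous_on (cball \<theta> \<delta>) f" unfolding f_def by (intro continuous_intros cont)
    then obtain \<phi> where \<phi>: "\<phi> \<in> cball \<theta> \<delta>" "\<And>y. y \<in> cball \<theta> \<delta> \<Longrightarrow> f y \<le> f \<phi>"
      using continuous_attains_sup[of "cball \<theta> \<delta>" f] \<delta> by auto
    have "f \<theta> \<le> f \<phi>" using \<delta> by (intro \<phi>) simp
    have max: "f y \<le> f \<phi>" if "y \<in> \<Theta>" for y
    proof (cases "y \<in> cball \<theta> \<delta>")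
      case False
      then have "f y < f \<theta>" using that S by (intro far) (auto simp: dist_norm norm_minus_commute)
      then show ?thesis using \<open>f \<theta> \<le> f \<phi>\<close> by simp
    qed (rule \<phi>)
    \<comment> \<open>Two maximizers would both lie in the ball, hence in \<open>\<Theta>\<close> together with their midpoint.\<close>
    have unique: "\<psi> = \<phi>" if \<psi>: "is_arg_max f (\<lambda>\<phi>. \<phi> \<in> \<Theta>) \<psi>" for \<psi>
    proof (rule ccontr)
      assume "\<psi> \<noteq> \<phi>"
      have "\<psi> \<in> \<Theta>" and \<psi>_max: "\<And>y. y \<in> \<Theta> \<Longrightarrow> f y \<le> f \<psi>"
        using \<psi> by (auto simp: is_arg_max_linorder)
      then have "\<not> f \<psi> < f \<theta>" using \<Theta> by (meson not_less)
      then have "norm (\<psi> - \<theta>) < \<delta>" using far[of \<psi>] \<open>\<psi> \<in> \<Theta>\<close> S by force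
      then have "\<psi> \<in> cball \<theta> \<delta>" by (simp add: dist_norm norm_minus_commute)
      then have "(1/2) *\<^sub>R \<psi> + (1/2) *\<^sub>R \<phi> \<in> cball \<theta> \<delta>"
        using \<phi> by (intro convexD[OF convex_cball]) auto
      then have "f ((1/2) *\<^sub>R \<psi> + (1/2) *\<^sub>R \<phi>) \<le> f \<phi>" "f \<phi> \<le> f \<psi>"
        using \<psi>_max \<phi> cball by auto
      moreover have "g ((1/2) *\<^sub>R \<psi> + (1/2) *\<^sub>R \<phi>) < (1/2) * g \<psi> + (1/2) * g \<phi>"
        using \<open>\<psi> \<noteq> \<phi>\<close> \<open>\<psi> \<in> \<Theta>\<close> \<phi> cball S by (intro strict) auto
      ultimately show False
        using max[OF \<open>\<psi> \<in> \<Theta>\<close>] by (simp add: f_def algebra_simps)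
    qed
    have "is_arg_max f (\<lambda>\<phi>. \<phi> \<in> \<Theta>) \<phi>" using \<phi>(1) cball max by (auto simp: is_arg_max_linorder)
    then have "\<forall>\<psi>. is_arg_max f (\<lambda>\<phi>. \<phi> \<in> \<Theta>) \<psi> \<longleftrightarrow> \<psi> = \<phi>" using unique by blast
    moreover have "\<phi> \<in> ball \<theta> \<epsilon>" using \<phi>(1) \<delta> by auto
    ultimately show "\<exists>\<phi>\<in>ball \<theta> \<epsilon>. \<forall>\<psi>. is_arg_max (\<lambda>\<phi>. \<phi> \<bullet> \<tau> n - g \<phi>) (\<lambda>\<phi>. \<phi> \<in> \<Theta>) \<psi> \<longleftrightarrow> \<psi> = \<phi>"
      unfolding f_def by blast
  qed
qed

section \<open>A strong law from bounded likelihood ratios\<close>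

text \<open>
  The hypothesis \<open>bounded\<close> is an upper bound for the log-likelihood ratio of \<open>\<theta> + v / Suc k\<close> against
  \<open>\<theta>\<close>. Dividing it by \<open>R n\<close> removes the constant and leaves the difference quotient of \<open>a\<close>;
  one \<open>k\<close> whose quotient is within \<open>\<epsilon> / 2\<close> of the derivative suffices, so \<open>C\<close> may depend on \<open>k\<close>.
\<close>

lemma directional_upper_bound:
  fixes a :: "'a::real_inner \<Rightarrow> real"
  assumes der: "(a has_derivative (\<lambda>v. m \<bullet> v)) (at \<theta>)"
    and R: "filterlim R at_top sequentially"
    and bounded: "\<forall>\<^sub>F k in sequentially. \<exists>C. \<forall>\<^sub>F n in sequentially.
          inverse (real (Suc k)) * (v \<bullet> s n) - R n * (a (\<theta> + inverse (real (Suc k)) *\<^sub>R v) - a \<theta>) \<le> C"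
    and "0 < \<epsilon>"
  shows "\<forall>\<^sub>F n in sequentially. v \<bullet> (s n /\<^sub>R R n) < m \<bullet> v + \<epsilon>"
proof -
  define q where "q u = (a (\<theta> + u *\<^sub>R v) - a \<theta>) / u" for u
  have "((\<lambda>u. \<theta> + u *\<^sub>R v) has_derivative (\<lambda>u. u *\<^sub>R v)) (at 0)"
    by (auto intro!: derivative_eq_intros)
  then have "((\<lambda>u. a (\<theta> + u *\<^sub>R v)) has_derivative (\<lambda>u. m \<bullet> (u *\<^sub>R v))) (at 0)"
    by (rule has_derivative_compose) (use der in simp)
  then have "((\<lambda>u. a (\<theta> + u *\<^sub>R v)) has_real_derivative m \<bullet> v) (at 0)"
    by (simp add: has_field_derivative_def mult_commute_abs)
  then have "(q \<longlongrightarrow> m \<bullet> v) (at 0)" unfolding DERIV_def q_def by simp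
  moreover have "filterlim (\<lambda>k. inverse (real (Suc k))) (at 0) sequentially"
    using LIMSEQ_inverse_real_of_nat by (simp add: filterlim_at)
  ultimately have "(\<lambda>k. q (inverse (real (Suc k)))) \<longlonglongrightarrow> m \<bullet> v" by (rule filterlim_compose)
  then have "\<forall>\<^sub>F k in sequentially. q (inverse (real (Suc k))) < m \<bullet> v + \<epsilon> / 2"
    using \<open>0 < \<epsilon>\<close> by (intro order_tendstoD) auto
  from eventually_happens[OF eventually_conj[OF this bounded]]
  obtain k C where k: "q (inverse (real (Suc k))) < m \<bullet> v + \<epsilon> / 2"
    and C: "\<forall>\<^sub>F n in sequentially.
          inverse (real (Suc k)) * (v \<bullet> s n) - R n * (a (\<theta> + inverse (real (Suc k)) *\<^sub>R v) - a \<theta>) \<le> C"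
    by auto
  define u where "u = inverse (real (Suc k))"
  have "0 < u" by (simp add: u_def)
  have "(\<lambda>n. (C / u) / R n) \<longlonglongrightarrow> 0"
    by (intro tendsto_divide_0[OF tendsto_const] filterlim_at_top_imp_at_infinity R)
  then have "\<forall>\<^sub>F n in sequentially. (C / u) / R n < \<epsilon> / 2"
    using \<open>0 < \<epsilon>\<close> by (intro order_tendstoD) auto
  moreover have "\<forall>\<^sub>F n in sequentially. 0 < R n"
    using R by (simp add: filterlim_at_top_dense)
  ultimately show ?thesis using C
  proof eventually_elim
    case (elim n)
    have "u * (v \<bullet> s n) \<le> R n * (u * q u) + C"
      using elim(3) \<open>0 < u\<close> unfolding q_def u_def by simp
    then have "v \<bullet> s n \<le> R n * q u + C / u"
      using \<open>0 < u\<close> by (simp add: field_simps)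
    then have "v \<bullet> (s n /\<^sub>R R n) \<le> q u + (C / u) / R n"
      using \<open>0 < R n\<close> by (simp add: field_simps)
    then show ?case using k elim(1) unfolding u_def[symmetric] by linarith
  qed
qed

context exponential_family_system
begin

section \<open>Likelihood ratios in a projective family\<close>

lemma partition_function_pos:
  assumes "A \<in> \<A>" "\<phi> \<in> \<Theta>"
  shows "0 < partition_function X t A \<phi>"
  unfolding partition_function_def
  using infsum_exp_pos[OF partition_finite[OF assms] config_nonempty[OF assms(1)]] .

lemma family_density_pos:
  assumes "A \<in> \<A>" "\<phi> \<in> \<Theta>"
  shows "0 < family_density X t A \<phi> x"
  unfolding family_density_def using partition_function_pos[OF assms] by simp

lemma emeasure_family_dist_space:
  assumes "A \<in> \<A>" "\<phi> \<in> \<Theta>"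
  shows "emeasure (family_dist X t A \<phi>) (X A) = 1"
proof -
  let ?p = "family_density X t A \<phi>"
  have sum: "(?p has_sum 1) (X A)"
    using has_sum_cmult_left[OF has_sum_infsum[OF partition_finite[OF assms]],
        of "inverse (partition_function X t A \<phi>)"] partition_function_pos[OF assms]
    by (simp add: family_density_def[abs_def] partition_function_def divide_inverse)
  then have summable: "Infinite_Set_Sum.abs_summable_on ?p (X A)"
    using family_density_pos[OF assms] has_sum_imp_summable
    by (simp add: abs_of_pos flip: abs_summable_equivalent)
  have "emeasure (family_dist X t A \<phi>) (X A) = (\<integral>\<^sup>+x. ennreal (?p x) \<partial>count_space (X A))"
    unfolding family_dist_def
    by (subst emeasure_density) (auto intro!: nn_integral_cong)
  also have "\<dots> = ennreal (infsetsum ?p (X A))"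
    using summable family_density_pos[OF assms]
    by (intro nn_integral_conv_infsetsum) (auto simp: less_imp_le)
  also have "infsetsum ?p (X A) = 1"
    using infsetsum_infsum[OF summable] infsumI[OF sum] by simp
  finally show ?thesis by simp
qed

lemma restrict_config:
  assumes "A \<in> \<A>" "B \<in> \<A>" "A \<subseteq> B" "x \<in> X B"
  shows "restrict x A \<in> X A"
  using config_split[OF assms(1-3)] assms(4) by blast

lemma emeasure_family_dist_projection:
  assumes "projective_exponential_family \<A> X \<Theta> t" "A \<in> \<A>" "B \<in> \<A>" "A \<subseteq> B" "\<phi> \<in> \<Theta>" "E \<subseteq> X A"
  shows "emeasure (family_dist X t A \<phi>) E = emeasure (family_dist X t B \<phi>) {x \<in> X B. restrict x A \<in> E}"
proof -
  have "family_dist X t A \<phi> = distr (family_dist X t B \<phi>) (count_space (X A)) (\<lambda>x. restrict x A)"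
    using assms unfolding projective_exponential_family_def by blast
  then have "emeasure (family_dist X t A \<phi>) E
      = emeasure (distr (family_dist X t B \<phi>) (count_space (X A)) (\<lambda>x. restrict x A)) E" by simp
  also have "\<dots> = emeasure (family_dist X t B \<phi>)
      ((\<lambda>x. restrict x A) -` E \<inter> space (family_dist X t B \<phi>))"
    using assms(6) restrict_config[OF assms(2-4)]
    by (intro emeasure_distr) (auto simp: family_dist_def measurable_def)
  also have "(\<lambda>x. restrict x A) -` E \<inter> space (family_dist X t B \<phi>) = {x \<in> X B. restrict x A \<in> E}"
    by (auto simp: family_dist_def)
  finally show ?thesis .
qed

text \<open>
  The event that the likelihood ratio of \<open>\<phi>\<close> against \<open>\<theta>\<close> reaches level \<open>c\<close> by time \<open>N\<close>. As it
  restricts its argument itself, it applies both to infinite configurations and to those on a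
  single \<open>A M\<close> with \<open>N \<le> M\<close>.
\<close>

definition ratio_crossing ::
    "(nat \<Rightarrow> 'i set) \<Rightarrow> real ^ 'd \<Rightarrow> real ^ 'd \<Rightarrow> real \<Rightarrow> nat \<Rightarrow> ('i \<Rightarrow> 'x) \<Rightarrow> bool"
  where "ratio_crossing A \<theta> \<phi> c N x \<longleftrightarrow>
    (\<exists>n\<le>N. c * family_density X t (A n) \<theta> (restrict x (A n))
            \<le> family_density X t (A n) \<phi> (restrict x (A n)))"

lemma ratio_crossing_restrict:
  assumes "incseq A" "N \<le> M"
  shows "ratio_crossing A \<theta> \<phi> c N (restrict x (A M)) = ratio_crossing A \<theta> \<phi> c N x"
proof -
  have "restrict (restrict x (A M)) (A n) = restrict x (A n)" if "n \<le> N" for n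
    using incseqD[OF assms(1), of n M] that assms(2) by (simp add: Int_absorb1)
  then show ?thesis unfolding ratio_crossing_def by auto
qed

text \<open>
  Ville's inequality by a change of measure. Where the ratio reaches \<open>c\<close> at the last time, the
  \<open>\<phi>\<close>-density is at least \<open>c\<close> times the \<open>\<theta>\<close>-density; an earlier crossing is an event of the smaller
  configuration, whose probabilities under both parameters are the same on the smaller and on the
  larger index set by projectivity. Induction on \<open>N\<close> splits the event accordingly.
\<close>

lemma ratio_crossing_maximal_inequality:
  assumes proj: "projective_exponential_family \<A> X \<Theta> t"
    and A: "\<And>n. A n \<in> \<A>" "incseq A" and par: "\<theta> \<in> \<Theta>" "\<phi> \<in> \<Theta>" and "0 \<le> c"
  shows "ennreal c * emeasure (family_dist X t (A N) \<theta>) {x \<in> X (A N). ratio_crossing A \<theta> \<phi> c N x}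
      \<le> emeasure (family_dist X t (A N) \<phi>) {x \<in> X (A N). ratio_crossing A \<theta> \<phi> c N x}"
proof -
  have pointwise: "ennreal c * emeasure (family_dist X t B \<theta>) D \<le> emeasure (family_dist X t B \<phi>) D"
    if D: "D \<subseteq> X B" "\<And>x. x \<in> D \<Longrightarrow> c * family_density X t B \<theta> x \<le> family_density X t B \<phi> x"
    for B D
  proof -
    have "ennreal c * emeasure (family_dist X t B \<theta>) D
        = (\<integral>\<^sup>+x. ennreal c * (ennreal (family_density X t B \<theta> x) * indicator D x) \<partial>count_space (X B))"
      using D(1) unfolding family_dist_def by (simp add: emeasure_density nn_integral_cmult)
    also have "\<dots> \<le> (\<integral>\<^sup>+x. ennreal (family_density X t B \<phi> x) * indicator D x \<partial>count_space (X B))"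
      using D(2) \<open>0 \<le> c\<close>
      by (intro nn_integral_mono) (auto simp: indicator_def ennreal_leI simp flip: ennreal_mult')
    also have "\<dots> = emeasure (family_dist X t B \<phi>) D"
      using D(1) unfolding family_dist_def by (simp add: emeasure_density)
    finally show ?thesis .
  qed
  show ?thesis
  proof (induction N)
    case 0
    have "restrict x (A 0) = x" if "x \<in> X (A 0)" for x
      using config_extensional[OF A(1), of 0] that by (auto intro: extensional_restrict)
    then show ?case by (intro pointwise) (auto simp: ratio_crossing_def)
  next
    case (Suc N)
    let ?B = "A (Suc N)"
    \<comment> \<open>\<open>E\<close>: crossed before the last step; \<open>D\<close>: crossed for the first time at the last step.\<close>
    define E where "E = {x \<in> X ?B. ratio_crossing A \<theta> \<phi> c N x}"
    define D where "D = {x \<in> X ?B. ratio_crossing A \<theta> \<phi> c (Suc N) x} - E"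
    have sub: "A N \<subseteq> ?B" using A(2) by (simp add: incseq_SucD)
    have pull: "emeasure (family_dist X t (A N) \<eta>) {x \<in> X (A N). ratio_crossing A \<theta> \<phi> c N x}
        = emeasure (family_dist X t ?B \<eta>) E" if "\<eta> \<in> \<Theta>" for \<eta>
    proof -
      have "{x \<in> X ?B. restrict x (A N) \<in> {x \<in> X (A N). ratio_crossing A \<theta> \<phi> c N x}} = E"
        using restrict_config[OF A(1) A(1) sub] ratio_crossing_restrict[OF A(2) order_refl]
        by (auto simp: E_def)
      then show ?thesis using emeasure_family_dist_projection[OF proj A(1) A(1) sub that] by simp
    qed
    have split: "{x \<in> X ?B. ratio_crossing A \<theta> \<phi> c (Suc N) x} = E \<union> D" "E \<inter> D = {}"
      unfolding D_def E_def ratio_crossing_def using le_SucI by blast+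
    have add: "emeasure (family_dist X t ?B \<eta>) (E \<union> D)
        = emeasure (family_dist X t ?B \<eta>) E + emeasure (family_dist X t ?B \<eta>) D" for \<eta>
      using split(2) by (intro plus_emeasure[symmetric]) (auto simp: family_dist_def E_def D_def)
    have "restrict x ?B = x" if "x \<in> X ?B" for x
      using config_extensional[OF A(1), of "Suc N"] that by (auto intro: extensional_restrict)
    then have "ennreal c * emeasure (family_dist X t ?B \<theta>) D \<le> emeasure (family_dist X t ?B \<phi>) D"
      by (intro pointwise) (auto simp: D_def E_def ratio_crossing_def le_Suc_eq)
    moreover have "ennreal c * emeasure (family_dist X t ?B \<theta>) E \<le> emeasure (family_dist X t ?B \<phi>) E"
      using Suc.IH by (simp add: pull par)
    ultimately show ?case
      unfolding split(1) add distrib_left by (rule add_mono[rotated])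
  qed
qed

text \<open>
  The probability that the ratio ever reaches level \<open>Suc k\<close> is at most \<open>1 / Suc k\<close>, as a limit of
  finite-horizon crossing probabilities, each a marginal of \<open>P\<close>. An unbounded ratio reaches all
  levels. The bound is stated without division, as an inequality between densities.
\<close>

lemma AE_likelihood_ratio_bounded:
  assumes proj: "projective_exponential_family \<A> X \<Theta> t"
    and A: "\<And>n. A n \<in> \<A>" "incseq A" and par: "\<theta> \<in> \<Theta>" "\<phi> \<in> \<Theta>"
    and P: "infinite_distribution \<A> X t \<theta> P"
  shows "AE \<omega> in P. \<exists>c. \<forall>n. family_density X t (A n) \<phi> (restrict \<omega> (A n))
            \<le> c * family_density X t (A n) \<theta> (restrict \<omega> (A n))"
proof -
  interpret prob_space P using P by (simp add: infinite_distribution_def)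
  define F where "F k N = {\<omega> \<in> space P. ratio_crossing A \<theta> \<phi> (real (Suc k)) N \<omega>}" for k N
  have F_eq: "F k N = (\<lambda>\<omega>. restrict \<omega> (A N)) -`
      {x \<in> X (A N). ratio_crossing A \<theta> \<phi> (real (Suc k)) N x} \<inter> space P" for k N
    using measurable_space[OF measurable_projection[OF A(1) P, of N]]
    by (auto simp: F_def ratio_crossing_restrict[OF A(2)])
  have F_sets [measurable]: "F k N \<in> sets P" for k N
    unfolding F_eq by (rule measurable_sets[OF measurable_projection[OF A(1) P]]) auto
  have F_bound: "ennreal (real (Suc k)) * emeasure P (F k N) \<le> 1" for k N
  proof -
    let ?E = "{x \<in> X (A N). ratio_crossing A \<theta> \<phi> (real (Suc k)) N x}"
    have "emeasure P (F k N) = emeasure (distr P (count_space (X (A N))) (\<lambda>\<omega>. restrict \<omega> (A N))) ?E"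
      unfolding F_eq
      by (rule emeasure_distr[symmetric, OF measurable_projection[OF A(1) P]]) auto
    also have "\<dots> = emeasure (family_dist X t (A N) \<theta>) ?E"
      using P A(1) unfolding infinite_distribution_def by simp
    finally have "ennreal (real (Suc k)) * emeasure P (F k N) \<le> emeasure (family_dist X t (A N) \<phi>) ?E"
      using ratio_crossing_maximal_inequality[OF proj A par, of "real (Suc k)" N] by simp
    also have "\<dots> \<le> emeasure (family_dist X t (A N) \<phi>) (X (A N))"
      by (rule emeasure_mono) (auto simp: family_dist_def)
    also have "\<dots> = 1" using A(1) par(2) by (rule emeasure_family_dist_space)
    finally show ?thesis .
  qed
  have F_prob: "prob (F k N) \<le> inverse (real (Suc k))" for k N
  proof -
    have "ennreal (real (Suc k) * prob (F k N)) \<le> ennreal 1"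
      using F_bound[of k N] by (simp add: emeasure_eq_measure ennreal_mult')
    then have "real (Suc k) * prob (F k N) \<le> 1" by (simp only: ennreal_le_iff)
    then show ?thesis by (simp add: field_simps)
  qed
  have "prob (\<Inter>k. \<Union>N. F k N) \<le> inverse (real (Suc k))" for k
  proof -
    have "incseq (F k)" unfolding F_def ratio_crossing_def incseq_def using le_trans by blast
    then have "(\<lambda>N. prob (F k N)) \<longlonglongrightarrow> prob (\<Union>N. F k N)"
      by (intro finite_Lim_measure_incseq) auto
    then have "prob (\<Union>N. F k N) \<le> inverse (real (Suc k))"
      using F_prob by (intro LIMSEQ_le_const2) auto
    moreover have "prob (\<Inter>k. \<Union>N. F k N) \<le> prob (\<Union>N. F k N)"
      by (intro finite_measure_mono) auto
    ultimately show ?thesis by simp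
  qed
  then have "prob (\<Inter>k. \<Union>N. F k N) \<le> 0"
    using LIMSEQ_inverse_real_of_nat by (intro LIMSEQ_le_const) auto
  then have null: "emeasure P (\<Inter>k. \<Union>N. F k N) = 0"
    by (simp add: emeasure_eq_measure measure_le_0_iff)
  show ?thesis
  proof (rule AE_I[OF _ null])
    show "{\<omega> \<in> space P. \<not> (\<exists>c. \<forall>n. family_density X t (A n) \<phi> (restrict \<omega> (A n))
            \<le> c * family_density X t (A n) \<theta> (restrict \<omega> (A n)))} \<subseteq> (\<Inter>k. \<Union>N. F k N)"
      unfolding F_def ratio_crossing_def by (force simp: not_le intro: less_imp_le)
  qed auto
qed

lemma family_density_eq_exp:
  assumes "A \<in> \<A>" "\<phi> \<in> \<Theta>"
  shows "family_density X t A \<phi> x = exp (\<phi> \<bullet> t A x - log_partition X t A \<phi>)"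
  using partition_function_pos[OF assms]
  by (simp add: family_density_def log_partition_def exp_diff)

text \<open>
  Only countably many alternatives \<open>\<theta> + v / Suc k\<close>, with \<open>v\<close> a signed basis vector, are compared with
  \<open>\<theta>\<close>, so their exceptional null sets can be united. The bound in direction \<open>- v\<close> is the
  lower bound in direction \<open>v\<close>.
\<close>

lemma AE_normalized_statistic_tendsto:
  assumes proj: "projective_exponential_family \<A> X \<Theta> t"
    and A: "\<And>n. A n \<in> \<A>" "incseq A" and "\<theta> \<in> \<Theta>"
    and P: "infinite_distribution \<A> X t \<theta> P"
    and der: "(a has_derivative (\<lambda>v. m \<bullet> v)) (at \<theta>)"
    and R: "filterlim R at_top sequentially"
    and scaling: "\<forall>\<^sub>F n in sequentially. \<forall>\<phi>\<in>\<Theta>. log_partition X t (A n) \<phi> = R n * a \<phi>"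
  shows "AE \<omega> in P. (\<lambda>n. t (A n) (restrict \<omega> (A n)) /\<^sub>R R n) \<longlonglongrightarrow> m"
proof -
  define V :: "(real ^ 'd) set" where "V = Basis \<union> uminus ` Basis"
  define Q where "Q = (\<lambda>(v, k). \<theta> + inverse (real (Suc k)) *\<^sub>R v) ` (V \<times> UNIV) \<inter> \<Theta>"
  have "countable Q"
    unfolding Q_def V_def
    by (intro countable_Int1 countable_image countable_SIGMA) (auto intro: countable_finite)
  moreover have "\<forall>\<phi>\<in>Q. AE \<omega> in P. \<exists>c. \<forall>n. family_density X t (A n) \<phi> (restrict \<omega> (A n))
            \<le> c * family_density X t (A n) \<theta> (restrict \<omega> (A n))"
    using AE_likelihood_ratio_bounded[OF proj A \<open>\<theta> \<in> \<Theta>\<close> _ P] by (simp add: Q_def)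
  ultimately have "AE \<omega> in P. \<forall>\<phi>\<in>Q. \<exists>c. \<forall>n. family_density X t (A n) \<phi> (restrict \<omega> (A n))
            \<le> c * family_density X t (A n) \<theta> (restrict \<omega> (A n))"
    by (simp add: AE_ball_countable)
  then show ?thesis
  proof eventually_elim
    case (elim \<omega>)
    define s where "s n = t (A n) (restrict \<omega> (A n))" for n
    have log_bound: "\<exists>C. \<forall>\<^sub>F n in sequentially. (\<phi> - \<theta>) \<bullet> s n - R n * (a \<phi> - a \<theta>) \<le> C"
      if Q: "\<phi> \<in> Q" for \<phi>
    proof -
      have "\<phi> \<in> \<Theta>" using Q by (simp add: Q_def)
      from bspec[OF elim Q] obtain c where c: "\<forall>n. family_density X t (A n) \<phi> (restrict \<omega> (A n))
            \<le> c * family_density X t (A n) \<theta> (restrict \<omega> (A n))" ..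
      have "0 < c * family_density X t (A 0) \<theta> (restrict \<omega> (A 0))"
        using family_density_pos[OF A(1) \<open>\<phi> \<in> \<Theta>\<close>] spec[OF c, of 0] by (rule less_le_trans)
      then have "0 < c"
        using family_density_pos[OF A(1) \<open>\<theta> \<in> \<Theta>\<close>] by (rule zero_less_mult_pos2)
      have "\<forall>\<^sub>F n in sequentially. (\<phi> - \<theta>) \<bullet> s n - R n * (a \<phi> - a \<theta>) \<le> ln c"
        using scaling
      proof eventually_elim
        case (elim n)
        have "exp (\<phi> \<bullet> s n - R n * a \<phi>) \<le> exp (ln c + (\<theta> \<bullet> s n - R n * a \<theta>))"
          using spec[OF c, of n] elim \<open>0 < c\<close> \<open>\<phi> \<in> \<Theta>\<close> \<open>\<theta> \<in> \<Theta>\<close>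
          by (simp add: family_density_eq_exp[OF A(1)] s_def exp_add)
        then show ?case by (simp add: algebra_simps)
      qed
      then show ?thesis ..
    qed
    have upper: "\<forall>\<^sub>F n in sequentially. v \<bullet> (s n /\<^sub>R R n) < m \<bullet> v + \<epsilon>"
      if "v \<in> V" "0 < \<epsilon>" for v \<epsilon>
    proof (rule directional_upper_bound[OF der R _ \<open>0 < \<epsilon>\<close>])
      have "(\<lambda>k. \<theta> + inverse (real (Suc k)) *\<^sub>R v) \<longlonglongrightarrow> \<theta> + 0 *\<^sub>R v"
        by (intro tendsto_intros LIMSEQ_inverse_real_of_nat)
      then have "\<forall>\<^sub>F k in sequentially. \<theta> + inverse (real (Suc k)) *\<^sub>R v \<in> \<Theta>"
        using topological_tendstoD[OF _ parameters_open] \<open>\<theta> \<in> \<Theta>\<close> by simp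
      then show "\<forall>\<^sub>F k in sequentially. \<exists>C. \<forall>\<^sub>F n in sequentially.
          inverse (real (Suc k)) * (v \<bullet> s n) - R n * (a (\<theta> + inverse (real (Suc k)) *\<^sub>R v) - a \<theta>) \<le> C"
      proof eventually_elim
        case (elim k)
        then have "\<theta> + inverse (real (Suc k)) *\<^sub>R v \<in> Q" using \<open>v \<in> V\<close> unfolding Q_def by auto
        from log_bound[OF this] show ?case by simp
      qed
    qed
    have "(\<lambda>n. (s n /\<^sub>R R n) \<bullet> b) \<longlonglongrightarrow> m \<bullet> b" if b: "b \<in> Basis" for b
    proof (rule tendstoI)
      fix \<epsilon> :: real assume "0 < \<epsilon>"
      have "b \<in> V" "- b \<in> V" using b by (auto simp: V_def)
      show "\<forall>\<^sub>F n in sequentially. dist ((s n /\<^sub>R R n) \<bullet> b) (m \<bullet> b) < \<epsilon>"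
        using upper[OF \<open>b \<in> V\<close> \<open>0 < \<epsilon>\<close>] upper[OF \<open>- b \<in> V\<close> \<open>0 < \<epsilon>\<close>]
      proof eventually_elim
        case (elim n)
        then show ?case
          unfolding inner_minus_left inner_minus_right inner_commute[of b] dist_real_def by linarith
      qed
    qed
    then show ?case unfolding s_def by (subst tendsto_componentwise_iff) blast
  qed
qed

end

section \<open>Existence and strong consistency\<close>

theorem theorem3:
  fixes I :: "'i set"
    and \<A> :: "'i set set"
    and X :: "'i set \<Rightarrow> ('i \<Rightarrow> 'x) set"
    and \<Theta> :: "(real ^ 'd) set"
    and t :: "'i set \<Rightarrow> ('i \<Rightarrow> 'x) \<Rightarrow> real ^ 'd"
    and sz :: "'i set \<Rightarrow> real"
    and r :: "real \<Rightarrow> real"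
    and a :: "real ^ 'd \<Rightarrow> real"
    and \<theta> :: "real ^ 'd"
    and P :: "('i \<Rightarrow> 'x) measure"
    and A :: "nat \<Rightarrow> 'i set"
  assumes system: "exponential_family_system I \<A> X \<Theta> t"
    and projective: "projective_exponential_family \<A> X \<Theta> t"
    and sz_pos: "\<And>B. B \<in> \<A> - {{}} \<Longrightarrow> 0 < sz B"
    and r_pos: "\<And>B. B \<in> \<A> - {{}} \<Longrightarrow> 0 < r (sz B)"
    and r_mono: "mono_on (sz ` (\<A> - {{}})) r"
    and scaling: "\<And>B \<phi>. B \<in> \<A> - {{}} \<Longrightarrow> \<phi> \<in> \<Theta> \<Longrightarrow> log_partition X t B \<phi> = r (sz B) * a \<phi>"
    and true_parameter: "\<theta> \<in> \<Theta>"
    and differentiable: "a differentiable (at \<theta>)"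
    and model: "infinite_distribution \<A> X t \<theta> P"
    and in_ideal: "\<And>n. A n \<in> \<A>"
    and growing: "incseq A"
    and diverging: "filterlim (\<lambda>n. r (sz (A n))) at_top sequentially"
  shows "AE \<omega> in P.
      (\<forall>\<^sub>F n in sequentially. \<exists>!\<phi>. is_mle X \<Theta> t (A n) (restrict \<omega> (A n)) \<phi>) \<and>
      (\<lambda>n. mle X \<Theta> t (A n) (restrict \<omega> (A n))) \<longlonglongrightarrow> \<theta>"
proof -
  interpret exponential_family_system I \<A> X \<Theta> t by (rule system)
  define R where "R n = r (sz (A n))" for n
  have R: "filterlim R at_top sequentially" using diverging by (simp add: R_def[abs_def])
  \<comment> \<open>The scaling relation says nothing about the empty set, but a sequence of empty sets has a
      constant scale factor, so \<open>A n\<close> is nonempty from some point on.\<close>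
  have "\<exists>N. A N \<noteq> {}"
  proof (rule ccontr)
    assume "\<not> ?thesis"
    then have "R n = r (sz {})" for n by (simp add: R_def)
    then show False using R less_irrefl by (simp add: filterlim_at_top_dense) blast
  qed
  then obtain N where "A N \<noteq> {}" ..
  have nonempty: "\<forall>\<^sub>F n in sequentially. A n \<in> \<A> - {{}}"
    using eventually_ge_at_top[of N]
  proof eventually_elim
    case (elim n)
    then show ?case using incseqD[OF growing elim] \<open>A N \<noteq> {}\<close> in_ideal by auto
  qed
  then have R_pos: "\<forall>\<^sub>F n in sequentially. 0 < R n"
    by eventually_elim (unfold R_def, rule r_pos)
  define B where "B = A N"
  have B: "B \<in> \<A>" "B \<in> \<A> - {{}}" using \<open>A N \<noteq> {}\<close> in_ideal by (auto simp: B_def)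
  \<comment> \<open>The log partition function of a single nonempty \<open>B\<close>, rescaled, extends \<open>a\<close> from \<open>\<Theta>\<close> to a
      strictly convex function \<open>g\<close> on a convex set \<open>S\<close>.\<close>
  define S where "S = {\<phi>. (\<lambda>x. exp (\<phi> \<bullet> t B x)) summable_on X B}"
  define g where "g \<phi> = log_partition X t B \<phi> / r (sz B)" for \<phi>
  have minimal: "minimal_statistic (X B) (t B)" using B statistic_minimal by auto
  have "\<Theta> \<subseteq> S" using partition_finite[OF B(1)] by (auto simp: S_def)
  have g_eq: "g \<phi> = a \<phi>" if "\<phi> \<in> \<Theta>" for \<phi>
    using scaling[OF B(2) that] r_pos[OF B(2)] by (simp add: g_def)
  note strictly_convex = log_partition_strictly_convex[where X = X and t = t and A = B, OF minimal config_nonempty[OF B(1)]]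
  have "convex S"
  proof (rule convexI)
    fix x y :: "real ^ 'd" and u v :: real
    assume *: "x \<in> S" "y \<in> S" "0 \<le> u" "0 \<le> v" "u + v = 1"
    show "u *\<^sub>R x + v *\<^sub>R y \<in> S"
    proof (cases "x = y \<or> u = 0 \<or> v = 0")
      case True
      then show ?thesis using * by (auto simp flip: scaleR_add_left)
    next
      case False
      then show ?thesis using * strictly_convex(1)[of x y u v] by (auto simp: S_def)
    qed
  qed
  have strict: "g (u *\<^sub>R x + v *\<^sub>R y) < u * g x + v * g y"
    if "x \<in> S" "y \<in> S" "x \<noteq> y" "0 < u" "0 < v" "u + v = 1" for x y u v
  proof -
    have "g (u *\<^sub>R x + v *\<^sub>R y) < (u * log_partition X t B x + v * log_partition X t B y) / r (sz B)"
      unfolding g_def using that r_pos[OF B(2)]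
      by (intro divide_strict_right_mono strictly_convex(2)) (auto simp: S_def)
    then show ?thesis by (simp add: g_def add_divide_distrib)
  qed
  obtain D where D: "(a has_derivative D) (at \<theta>)" using differentiable by (auto simp: differentiable_def)
  \<comment> \<open>The gradient of \<open>a\<close> at \<open>\<theta>\<close>: the vector that represents \<open>D\<close>.\<close>
  define m where "m = adjoint D 1"
  have "D = (\<lambda>v. m \<bullet> v)"
    using adjoint_works[OF has_derivative_linear[OF D], of _ 1] by (auto simp: m_def inner_commute)
  with D have der_a: "(a has_derivative (\<lambda>v. m \<bullet> v)) (at \<theta>)" by simp
  have der_g: "(g has_derivative (\<lambda>v. m \<bullet> v)) (at \<theta>)"
    using der_a parameters_open true_parameter
    by (rule has_derivative_transform_within_open) (simp add: g_eq)
  have log_partition_A: "\<forall>\<^sub>F n in sequentially. \<forall>\<phi>\<in>\<Theta>. log_partition X t (A n) \<phi> = R n * a \<phi>"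
    using nonempty by eventually_elim (auto simp: R_def intro: scaling)
  show ?thesis
    using AE_normalized_statistic_tendsto[OF projective in_ideal growing true_parameter model der_a R
        log_partition_A]
  proof eventually_elim
    case (elim \<omega>)
    let ?mle = "\<lambda>n. is_mle X \<Theta> t (A n) (restrict \<omega> (A n))"
    define \<tau> where "\<tau> n = t (A n) (restrict \<omega> (A n)) /\<^sub>R R n" for n
    have \<tau>: "\<tau> \<longlonglongrightarrow> m" using elim by (simp add: \<tau>_def[abs_def])
    have mle_iff: "\<forall>\<^sub>F n in sequentially. \<forall>\<psi>. ?mle n \<psi>
        \<longleftrightarrow> is_arg_max (\<lambda>\<phi>. \<phi> \<bullet> \<tau> n - g \<phi>) (\<lambda>\<phi>. \<phi> \<in> \<Theta>) \<psi>"
      using R_pos log_partition_A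
    proof eventually_elim
      case (elim n)
      have "family_density X t (A n) \<phi> (restrict \<omega> (A n)) = exp (R n * (\<phi> \<bullet> \<tau> n - g \<phi>))"
        if "\<phi> \<in> \<Theta>" for \<phi>
        using elim that
        by (simp add: family_density_eq_exp[OF in_ideal that] g_eq \<tau>_def right_diff_distrib)
      then show ?case
        using elim(1) by (auto simp: is_mle_def is_arg_max_linorder)
    qed
    have near: "\<forall>\<^sub>F n in sequentially. \<exists>\<phi>\<in>ball \<theta> \<epsilon>. \<forall>\<psi>. ?mle n \<psi> \<longleftrightarrow> \<psi> = \<phi>" if "0 < \<epsilon>" for \<epsilon>
    proof -
      have "\<forall>\<^sub>F n in sequentially. \<exists>\<phi>\<in>ball \<theta> \<epsilon>.
          \<forall>\<psi>. is_arg_max (\<lambda>\<phi>. \<phi> \<bullet> \<tau> n - g \<phi>) (\<lambda>\<phi>. \<phi> \<in> \<Theta>) \<psi> \<longleftrightarrow> \<psi> = \<phi>"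
        by (rule tilted_concave_argmax_near[OF \<open>convex S\<close> \<open>\<Theta> \<subseteq> S\<close> parameters_open true_parameter
              _ der_g \<tau> that]) (rule strict)
      then show ?thesis using mle_iff by eventually_elim simp
    qed
    have "\<forall>\<^sub>F n in sequentially. \<exists>!\<phi>. ?mle n \<phi>"
      using near[OF zero_less_one] by eventually_elim auto
    moreover have "(\<lambda>n. mle X \<Theta> t (A n) (restrict \<omega> (A n))) \<longlonglongrightarrow> \<theta>"
    proof (rule tendstoI)
      fix \<epsilon> :: real assume "0 < \<epsilon>"
      from near[OF this]
      show "\<forall>\<^sub>F n in sequentially. dist (mle X \<Theta> t (A n) (restrict \<omega> (A n))) \<theta> < \<epsilon>"
      proof eventually_elim
        case (elim n)
        then obtain \<phi> where \<phi>: "\<phi> \<in> ball \<theta> \<epsilon>" "\<And>\<psi>. ?mle n \<psi> \<longleftrightarrow> \<psi> = \<phi>" by blast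
        have "mle X \<Theta> t (A n) (restrict \<omega> (A n)) = (SOME \<psi>. ?mle n \<psi>)"
          unfolding mle_def arg_max_def is_mle_def ..
        also have "\<dots> = \<phi>" using \<phi>(2) by simp
        finally show ?case using \<phi>(1) by (simp add: dist_commute)
      qed
    qed
    ultimately show ?case by blast
  qed
qed

end
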